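(* Let $1\le m\le n$ be an integer batch-size, and let $B=B_m$ and $B_\mu=B_{\mu,m}$ be the mini-batch operators. For any function $J:\mathcal{S}\to\mathbb{R}$ and any stationary policy $\mu$, $$J^*=\lim_{k\to\infty}B^kJ\qquad\text{and}\qquad J_\mu=\lim_{k\to\infty}B_\mu^kJ,$$ where $J^*$ is the optimal cost function and $J_\mu$ is the cost function of $\mu$ (limits of functions on the finite set $\mathcal{S}$).
   Context: A (finite, discounted) Markov decision process is a tuple $(\mathcal{S},\mathcal{U},P,g,\alpha)$ with finite state space $\mathcal{S}=\{1,\dots,n\}$, finite control space $\mathcal{U}$, nonempty subsets $\mathcal{U}(i)\subseteq\mathcal{U}$ of controls associated with each state $i$, transition probabilities $p_{ij}(u)\in[0,1]$ (probability of moving from state $i$ to state $j$ under control $u\in\mathcal{U}(i)$, so $\sum_{j\in\mathcal{S}}p_{ij}(u)=1$), stage cost $g:\mathcal{S}\times\mathcal{U}\to\mathbb{R}$, and discount factor $\alpha\in(0,1)$. Fix such an MDP. A stationary (admissible) policy is a map $\mu:\mathcal{S}\to\mathcal{U}$ with $\mu(i)\in\mathcal{U}(i)$ for all $i$; $\Pi$ is the set of all such policies. The cost of $\mu$ is $J_\mu(i_0)=\lim_{N\to\infty}\mathbb{E}_\mu\left[\sum_{t=0}^{N-1}\alpha^t g(i_t,\mu(i_t))\right]$, the expectation being over the state sequence generated from $i_0$ under $\mu$. The optimal cost function is $J^*(i)=\min_{\mu\in\Pi}J_\mu(i)$, $i\in\mathcal{S}$. Mini-batch operators: for an integer batch-size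 $1\le m\le n$, let $\mathcal{M}_m(i)=\{j\in\mathbb{N}: 1\le j\le m\lfloor (i-1)/m\rfloor\}$ (empty if $\lfloor (i-1)/m\rfloor=0$), so $\mathcal{M}_m(i)\subseteq\{1,\dots,i-1\}$. For $J:\mathcal{S}\to\mathbb{R}$, the functions $B_mJ,B_{\mu,m}J:\mathcal{S}\to\mathbb{R}$ are defined recursively in increasing $i$ by $$(B_mJ)(i)=\min_{u\in\mathcal{U}(i)}\left[g(i,u)+\alpha\sum_{j\in\mathcal{S}\setminus\mathcal{M}_m(i)}p_{ij}(u)J(j)+\alpha\sum_{j\in\mathcal{M}_m(i)}p_{ij}(u)(B_mJ)(j)\right],$$ $$(B_{\mu,m}J)(i)=g(i,\mu(i))+\alpha\sum_{j\in\mathcal{S}\setminus\mathcal{M}_m(i)}p_{ij}(\mu(i))J(j)+\alpha\sum_{j\in\mathcal{M}_m(i)}p_{ij}(\mu(i))(B_{\mu,m}J)(j).$$ A superscript $k$ on an operator denotes its $k$-fold composition with itself. *)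

theory Defs
  imports "HOL-Probability.Probability_Mass_Function"
begin

text \<open>
  The state space is \<open>{1..n}\<close>; functions on it are functions on \<open>nat\<close> whose values outside
  \<open>{1..n}\<close> are irrelevant. \<open>U\<close> is the control space, \<open>A i\<close> the set of controls
  available in state \<open>i\<close>, and \<open>p i u\<close> the law of the successor of state \<open>i\<close> under control
  \<open>u\<close>, so that the transition probability from \<open>i\<close> to \<open>j\<close> is \<open>pmf (p i u) j\<close>. The
  stage cost \<open>g\<close> is unconstrained.
\<close>

definition finite_mdp ::
  "nat \<Rightarrow> 'u set \<Rightarrow> (nat \<Rightarrow> 'u set) \<Rightarrow> (nat \<Rightarrow> 'u \<Rightarrow> nat pmf) \<Rightarrow> real \<Rightarrow> bool" where
  "finite_mdp n U A p \<alpha> \<longleftrightarrow>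
     finite U \<and>
     (\<forall>i\<in>{1..n}. A i \<noteq> {} \<and> A i \<subseteq> U) \<and>
     (\<forall>i\<in>{1..n}. \<forall>u\<in>A i. set_pmf (p i u) \<subseteq> {1..n}) \<and>
     0 < \<alpha> \<and> \<alpha> < 1"

text \<open>
  Policies are taken extensional, so that they are exactly the maps on \<open>{1..n}\<close> and there are
  only finitely many of them.
\<close>

definition policies :: "nat \<Rightarrow> (nat \<Rightarrow> 'u set) \<Rightarrow> (nat \<Rightarrow> 'u) set" where
  "policies n A = Pi\<^sub>E {1..n} A"

text \<open>
  Joint law of the states \<open>[i\<^sub>0, \<dots>, i\<^sub>N]\<close> generated from \<open>i\<^sub>0 = i\<close> under \<open>\<mu>\<close>.
\<close>

primrec trajectory ::
  "(nat \<Rightarrow> 'u \<Rightarrow> nat pmf) \<Rightarrow> (nat \<Rightarrow> 'u) \<Rightarrow> nat \<Rightarrow> nat \<Rightarrow> nat list pmf" where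
  "trajectory p \<mu> 0 i = return_pmf [i]"
| "trajectory p \<mu> (Suc N) i =
     bind_pmf (p i (\<mu> i)) (\<lambda>j. map_pmf (\<lambda>\<omega>. i # \<omega>) (trajectory p \<mu> N j))"

definition policy_cost ::
  "(nat \<Rightarrow> 'u \<Rightarrow> nat pmf) \<Rightarrow> (nat \<Rightarrow> 'u \<Rightarrow> real) \<Rightarrow> real \<Rightarrow> (nat \<Rightarrow> 'u) \<Rightarrow> nat \<Rightarrow> real" where
  "policy_cost p g \<alpha> \<mu> i =
     lim (\<lambda>N. measure_pmf.expectation (trajectory p \<mu> N i)
                (\<lambda>\<omega>. \<Sum>t<N. \<alpha> ^ t * g (\<omega> ! t) (\<mu> (\<omega> ! t))))"

definition optimal_cost ::
  "nat \<Rightarrow> (nat \<Rightarrow> 'u set) \<Rightarrow> (nat \<Rightarrow> 'u \<Rightarrow> nat pmf) \<Rightarrow> (nat \<Rightarrow> 'u \<Rightarrow> real) \<Rightarrow> real \<Rightarrow> nat \<Rightarrow> real" where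
  "optimal_cost n A p g \<alpha> i = (MIN \<mu>\<in>policies n A. policy_cost p g \<alpha> \<mu> i)"

definition batch :: "nat \<Rightarrow> nat \<Rightarrow> nat set" where
  "batch m i = {1..m * ((i - 1) div m)}"

lemma batch_less:
  assumes "j \<in> batch m i"
  shows "j < i"
proof -
  have "1 \<le> j" "j \<le> m * ((i - 1) div m)"
    using assms by (auto simp: batch_def)
  moreover have "m * ((i - 1) div m) \<le> i - 1"
    by (rule times_div_less_eq_dividend)
  ultimately show ?thesis by linarith
qed

function batch_op ::
  "nat \<Rightarrow> (nat \<Rightarrow> 'u set) \<Rightarrow> (nat \<Rightarrow> 'u \<Rightarrow> nat pmf) \<Rightarrow> (nat \<Rightarrow> 'u \<Rightarrow> real) \<Rightarrow> real \<Rightarrow>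
   nat \<Rightarrow> (nat \<Rightarrow> real) \<Rightarrow> nat \<Rightarrow> real" where
  "batch_op n A p g \<alpha> m J i =
     (MIN u\<in>A i. g i u
        + \<alpha> * (\<Sum>j\<in>{1..n} - batch m i. pmf (p i u) j * J j)
        + \<alpha> * (\<Sum>j\<in>batch m i. pmf (p i u) j * batch_op n A p g \<alpha> m J j))"
  by pat_completeness auto
termination
  by (relation "Wellfounded.measure (\<lambda>(n, A, p, g, \<alpha>, m, J, i). i)") (auto simp: batch_less)

function policy_batch_op ::
  "nat \<Rightarrow> (nat \<Rightarrow> 'u \<Rightarrow> nat pmf) \<Rightarrow> (nat \<Rightarrow> 'u \<Rightarrow> real) \<Rightarrow> real \<Rightarrow>
   (nat \<Rightarrow> 'u) \<Rightarrow> nat \<Rightarrow> (nat \<Rightarrow> real) \<Rightarrow> nat \<Rightarrow> real" where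
  "policy_batch_op n p g \<alpha> \<mu> m J i =
     g i (\<mu> i)
       + \<alpha> * (\<Sum>j\<in>{1..n} - batch m i. pmf (p i (\<mu> i)) j * J j)
       + \<alpha> * (\<Sum>j\<in>batch m i. pmf (p i (\<mu> i)) j * policy_batch_op n p g \<alpha> \<mu> m J j)"
  by pat_completeness auto
termination
  by (relation "Wellfounded.measure (\<lambda>(n, p, g, \<alpha>, \<mu>, m, J, i). i)") (auto simp: batch_less)

declare batch_op.simps [simp del] policy_batch_op.simps [simp del]

end

theory Submission
  imports Defs
begin

text \<open>
  The classical Bellman operator \<open>T\<close> is an \<open>\<alpha>\<close>-contraction in the supremum norm, and the
  mini-batch operator evaluates \<open>T\<close> at \<open>i\<close> on a vector that mixes old values with values
  already updated (\<open>batch_op_eq_bellman\<close>). By strong induction along the states, the updated values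
  of two inputs are never further apart than the inputs, so the mixing costs nothing: the mini-batch
  operator is again an \<open>\<alpha>\<close>-contraction (\<open>contraction_batch_op\<close>), and by the same induction it
  fixes every solution of the Bellman equation (\<open>batch_op_fixed\<close>). Hence its iterates converge to
  the solution of the Bellman equation, whatever the batch size.

  It remains to identify that solution. A fixed policy \<open>\<mu>\<close> is treated as an MDP in its own right, in
  which \<open>\<mu> i\<close> is the only control available at \<open>i\<close>; all statements about optimal control
  then specialise to policy evaluation. Conditioning on the first transition shows that the
  expected \<open>N\<close>-stage costs are the iterates of the Bellman operator of that MDP started at \<open>0\<close>, so
  they converge and \<open>J\<^sub>\<mu>\<close> is the solution of its Bellman equation (\<open>policy_cost_eq\<close>).
  Finally the solution of the Bellman equation of the full MDP lies below every \<open>J\<^sub>\<mu>\<close>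
  and is attained by a greedy policy, so it is \<open>J\<^sup>*\<close> (\<open>optimal_cost_eq\<close>).
\<close>

section \<open>Contractions in the supremum norm over a set of coordinates\<close>

text \<open>
  Cost functions live on a whole type of which only the values on \<open>S\<close> matter, so
  distances are expressed by uniform bounds over \<open>S\<close> in place of a metric on the type.
\<close>

definition contraction_on :: "'a set \<Rightarrow> real \<Rightarrow> (('a \<Rightarrow> real) \<Rightarrow> 'a \<Rightarrow> real) \<Rightarrow> bool" where
  "contraction_on S \<alpha> F \<longleftrightarrow>
     (\<forall>x y c. (\<forall>j\<in>S. \<bar>x j - y j\<bar> \<le> c) \<longrightarrow> (\<forall>i\<in>S. \<bar>F x i - F y i\<bar> \<le> \<alpha> * c))"

lemma contraction_onD:
  assumes "contraction_on S \<alpha> F" "\<And>j. j \<in> S \<Longrightarrow> \<bar>x j - y j\<bar> \<le> c" "i \<in> S"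
  shows "\<bar>F x i - F y i\<bar> \<le> \<alpha> * c"
  using assms unfolding contraction_on_def by blast

lemma contraction_on_funpow:
  assumes F: "contraction_on S \<alpha> F" and c: "\<And>j. j \<in> S \<Longrightarrow> \<bar>x j - y j\<bar> \<le> c" and "i \<in> S"
  shows "\<bar>(F ^^ k) x i - (F ^^ k) y i\<bar> \<le> \<alpha> ^ k * c"
  using \<open>i \<in> S\<close>
proof (induction k arbitrary: i)
  case 0
  then show ?case using c by simp
next
  case (Suc k)
  from contraction_onD[OF F Suc.IH Suc.prems] show ?case
    by (simp add: mult.assoc)
qed

lemma finite_bounded_abs:
  fixes f :: "'a \<Rightarrow> real"
  assumes "finite S"
  obtains c where "\<And>i. i \<in> S \<Longrightarrow> \<bar>f i\<bar> \<le> c"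
proof
  fix i assume "i \<in> S"
  then show "\<bar>f i\<bar> \<le> (\<Sum>j\<in>S. \<bar>f j\<bar>)"
    using assms by (intro member_le_sum) auto
qed

lemma contraction_on_fixed_exists:
  assumes F: "contraction_on S \<alpha> F" and S: "finite S" and \<alpha>: "0 \<le> \<alpha>" "\<alpha> < 1"
  obtains V where "\<And>i. i \<in> S \<Longrightarrow> F V i = V i"
proof -
  define x where "x k = (F ^^ k) (\<lambda>_. 0)" for k
  obtain c where c: "\<bar>F (\<lambda>_. 0) i - 0\<bar> \<le> c" if "i \<in> S" for i
    using finite_bounded_abs[OF S, of "\<lambda>i. F (\<lambda>_. 0) i - 0"] by blast
  have step: "\<bar>x (Suc k) i - x k i\<bar> \<le> \<alpha> ^ k * c" if "i \<in> S" for i k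
    using contraction_on_funpow[OF F c that, where k = k] by (simp add: x_def funpow_swap1)
  define V where "V i = lim (\<lambda>k. x k i)" for i
  have x_V: "(\<lambda>k. x k i) \<longlonglongrightarrow> V i" if "i \<in> S" for i
  proof -
    have "summable (\<lambda>k. x (Suc k) i - x k i)"
      by (rule summable_comparison_test'[where N = 0 and g = "\<lambda>k. \<alpha> ^ k * c"])
        (use \<alpha> step[OF that] in \<open>auto intro!: summable_mult2 summable_geometric\<close>)
    moreover have "(\<Sum>l<k. x (Suc l) i - x l i) = x k i - x 0 i" for k
      by (rule sum_lessThan_telescope)
    ultimately have "convergent (\<lambda>k. x k i - x 0 i)"
      unfolding summable_iff_convergent by (simp only:)
    then have "convergent (\<lambda>k. (x k i - x 0 i) + x 0 i)"
      by (intro convergent_add convergent_const)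
    then show ?thesis by (simp add: convergent_LIMSEQ_iff V_def)
  qed
  have "F V i = V i" if i: "i \<in> S" for i
  proof -
    have "(\<lambda>k. \<Sum>j\<in>S. \<bar>x k j - V j\<bar>) \<longlonglongrightarrow> (\<Sum>j\<in>S. \<bar>V j - V j\<bar>)"
      by (intro tendsto_intros x_V)
    then have null: "(\<lambda>k. \<alpha> * (\<Sum>j\<in>S. \<bar>x k j - V j\<bar>)) \<longlonglongrightarrow> 0"
      using tendsto_mult_right_zero by force
    have bound: "\<bar>x (Suc k) i - F V i\<bar> \<le> \<alpha> * (\<Sum>j\<in>S. \<bar>x k j - V j\<bar>)" for k
    proof -
      have "\<bar>x k j - V j\<bar> \<le> (\<Sum>j\<in>S. \<bar>x k j - V j\<bar>)" if "j \<in> S" for j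
        using that S by (intro member_le_sum) auto
      from contraction_onD[OF F this i] show ?thesis
        by (simp add: x_def)
    qed
    have "(\<lambda>k. x (Suc k) i - F V i) \<longlonglongrightarrow> 0"
      by (rule Lim_null_comparison[OF _ null]) (simp add: bound)
    then have "(\<lambda>k. x (Suc k) i) \<longlonglongrightarrow> F V i"
      by (simp add: Lim_null[symmetric])
    moreover have "(\<lambda>k. x (Suc k) i) \<longlonglongrightarrow> V i"
      by (rule LIMSEQ_Suc) (rule x_V[OF i])
    ultimately show ?thesis by (rule LIMSEQ_unique)
  qed
  then show thesis by (rule that)
qed

text \<open>
  The fixed-point equation is required on \<open>S\<close> only, so the iterates of \<open>F\<close> on \<open>V\<close> agree with
  \<open>V\<close> on \<open>S\<close> but possibly nowhere else.
\<close>

lemma contraction_on_iterates_tendsto: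
  assumes F: "contraction_on S \<alpha> F" and S: "finite S" and \<alpha>: "0 \<le> \<alpha>" "\<alpha> < 1"
    and V: "\<And>i. i \<in> S \<Longrightarrow> F V i = V i" and i: "i \<in> S"
  shows "(\<lambda>k. (F ^^ k) x i) \<longlonglongrightarrow> V i"
proof -
  obtain c where c: "\<bar>x i - V i\<bar> \<le> c" if "i \<in> S" for i
    using finite_bounded_abs[OF S, of "\<lambda>i. x i - V i"] by blast
  have fixed: "(F ^^ k) V i = V i" if "i \<in> S" for i k
    using that
  proof (induction k arbitrary: i)
    case (Suc k)
    have "\<bar>F ((F ^^ k) V) i - F V i\<bar> \<le> \<alpha> * 0"
      by (rule contraction_onD[OF F _ Suc.prems]) (simp add: Suc.IH)
    then show ?case using V[OF Suc.prems] by simp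
  qed simp
  have null: "(\<lambda>k. \<alpha> ^ k * c) \<longlonglongrightarrow> 0"
    using \<alpha> by (intro tendsto_mult_left_zero LIMSEQ_power_zero) simp
  have bound: "\<bar>(F ^^ k) x i - V i\<bar> \<le> \<alpha> ^ k * c" for k
  proof -
    have "\<bar>(F ^^ k) x i - (F ^^ k) V i\<bar> \<le> \<alpha> ^ k * c"
      by (rule contraction_on_funpow[OF F _ i]) (rule c)
    then show ?thesis by (simp only: fixed[OF i])
  qed
  have "(\<lambda>k. (F ^^ k) x i - V i) \<longlonglongrightarrow> 0"
    by (rule Lim_null_comparison[OF _ null]) (simp add: bound)
  then show ?thesis by (simp add: Lim_null[symmetric])
qed

lemma abs_Min_diff_le:
  fixes f h :: "'a \<Rightarrow> real"
  assumes "finite B" "B \<noteq> {}" and d: "\<And>u. u \<in> B \<Longrightarrow> \<bar>f u - h u\<bar> \<le> d"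
  shows "\<bar>(MIN u\<in>B. f u) - (MIN u\<in>B. h u)\<bar> \<le> d"
proof -
  have le: "(MIN u\<in>B. f u) \<le> (MIN u\<in>B. h u) + d"
    if d: "\<And>u. u \<in> B \<Longrightarrow> \<bar>f u - h u\<bar> \<le> d" for f h :: "'a \<Rightarrow> real"
  proof -
    have "(MIN u\<in>B. h u) \<in> h ` B" using assms by (intro Min_in) auto
    then obtain v where v: "v \<in> B" "(MIN u\<in>B. h u) = h v" by auto
    have "(MIN u\<in>B. f u) \<le> f v" using assms v by (intro Min_le) auto
    then show ?thesis using d[OF v(1)] v by linarith
  qed
  show ?thesis using le[of f h] le[of h f] d by (simp add: abs_le_iff abs_minus_commute)
qed

section \<open>The Bellman operator and the mini-batch operators\<close>

lemma batch_subset: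
  assumes "i \<in> {1..n}"
  shows "batch m i \<subseteq> {1..n}"
proof
  fix j assume j: "j \<in> batch m i"
  then have "1 \<le> j" by (simp add: batch_def)
  with batch_less[OF j] assms show "j \<in> {1..n}" by simp
qed

locale mdp =
  fixes n :: nat and U :: "'u set" and A :: "nat \<Rightarrow> 'u set"
    and p :: "nat \<Rightarrow> 'u \<Rightarrow> nat pmf" and g :: "nat \<Rightarrow> 'u \<Rightarrow> real" and \<alpha> :: real
  assumes mdp: "finite_mdp n U A p \<alpha>"
begin

lemma \<alpha>: "0 < \<alpha>" "\<alpha> < 1"
  using mdp by (auto simp: finite_mdp_def)

lemma controls:
  assumes "i \<in> {1..n}"
  shows "finite (A i)" "A i \<noteq> {}"
proof -
  from assms have "finite U" "A i \<subseteq> U" "A i \<noteq> {}"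
    using mdp by (auto simp: finite_mdp_def)
  then show "finite (A i)" "A i \<noteq> {}" by (auto intro: finite_subset)
qed

lemma successors: "i \<in> {1..n} \<Longrightarrow> u \<in> A i \<Longrightarrow> set_pmf (p i u) \<subseteq> {1..n}"
  using mdp by (auto simp: finite_mdp_def)

lemma weighted_mean_le:
  assumes "i \<in> {1..n}" "u \<in> A i" and "\<And>j. j \<in> {1..n} \<Longrightarrow> f j \<le> c"
  shows "(\<Sum>j\<in>{1..n}. pmf (p i u) j * f j) \<le> c"
proof -
  have "(\<Sum>j\<in>{1..n}. pmf (p i u) j * f j) \<le> (\<Sum>j\<in>{1..n}. pmf (p i u) j * c)"
    using assms by (intro sum_mono mult_left_mono) auto
  also have "\<dots> = c"
    using sum_pmf_eq_1[OF _ successors[OF assms(1,2)]] by (simp flip: sum_distrib_right)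
  finally show ?thesis .
qed

definition bellman :: "(nat \<Rightarrow> real) \<Rightarrow> nat \<Rightarrow> real" where
  "bellman J i = (MIN u\<in>A i. g i u + \<alpha> * (\<Sum>j\<in>{1..n}. pmf (p i u) j * J j))"

lemma contraction_bellman: "contraction_on {1..n} \<alpha> bellman"
  unfolding contraction_on_def
proof safe
  fix x y :: "nat \<Rightarrow> real" and c i
  assume c: "\<forall>j\<in>{1..n}. \<bar>x j - y j\<bar> \<le> c" and i: "i \<in> {1..n}"
  show "\<bar>bellman x i - bellman y i\<bar> \<le> \<alpha> * c"
    unfolding bellman_def
  proof (rule abs_Min_diff_le[OF controls[OF i]])
    fix u assume u: "u \<in> A i"
    let ?E = "\<lambda>f. \<Sum>j\<in>{1..n}. pmf (p i u) j * f j"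
    have "\<bar>?E x - ?E y\<bar> = \<bar>\<Sum>j\<in>{1..n}. pmf (p i u) j * (x j - y j)\<bar>"
      by (simp add: sum_subtractf right_diff_distrib)
    also have "\<dots> \<le> (\<Sum>j\<in>{1..n}. pmf (p i u) j * \<bar>x j - y j\<bar>)"
      by (rule order_trans[OF sum_abs]) (simp add: abs_mult)
    also have "\<dots> \<le> c"
      using c by (intro weighted_mean_le i u) auto
    finally have "\<alpha> * \<bar>?E x - ?E y\<bar> \<le> \<alpha> * c"
      using \<alpha> by (intro mult_left_mono) auto
    then show "\<bar>g i u + \<alpha> * ?E x - (g i u + \<alpha> * ?E y)\<bar> \<le> \<alpha> * c"
      using \<alpha> by (simp add: abs_mult flip: right_diff_distrib)
  qed
qed

lemma bellman_cong:
  assumes "\<And>j. j \<in> {1..n} \<Longrightarrow> x j = y j"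
  shows "bellman x i = bellman y i"
proof -
  have "(\<Sum>j\<in>{1..n}. pmf (p i u) j * x j) = (\<Sum>j\<in>{1..n}. pmf (p i u) j * y j)" for u
    using assms by (intro sum.cong) auto
  then show ?thesis by (simp add: bellman_def)
qed

lemma batch_op_eq_bellman:
  assumes i: "i \<in> {1..n}"
  shows "batch_op n A p g \<alpha> m J i =
    bellman (\<lambda>j. if j \<in> batch m i then batch_op n A p g \<alpha> m J j else J j) i"
proof -
  let ?x = "\<lambda>j. if j \<in> batch m i then batch_op n A p g \<alpha> m J j else J j"
  have "(\<Sum>j\<in>{1..n}. pmf (p i u) j * ?x j) =
      (\<Sum>j\<in>{1..n} - batch m i. pmf (p i u) j * J j)
      + (\<Sum>j\<in>batch m i. pmf (p i u) j * batch_op n A p g \<alpha> m J j)" for u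
    by (subst sum.subset_diff[OF batch_subset[OF i, of m]]) simp_all
  then show ?thesis
    by (subst batch_op.simps) (simp add: bellman_def distrib_left add.assoc)
qed

text \<open>
  Why mixing old and updated values does not spoil the contraction: at the states of \<open>batch m i\<close>
  the updated values differ by at most \<open>\<alpha> * c \<le> c\<close> by induction, at the remaining states the
  inputs differ by at most \<open>c\<close>. So the two mixed vectors are at distance at most \<open>c\<close>, and the Bellman
  operator contributes the factor \<open>\<alpha>\<close>.
\<close>

lemma contraction_batch_op: "contraction_on {1..n} \<alpha> (batch_op n A p g \<alpha> m)"
  unfolding contraction_on_def
proof safe
  fix x y :: "nat \<Rightarrow> real" and c i
  assume c: "\<forall>j\<in>{1..n}. \<bar>x j - y j\<bar> \<le> c" and "i \<in> {1..n}"
  from this(2) show "\<bar>batch_op n A p g \<alpha> m x i - batch_op n A p g \<alpha> m y i\<bar> \<le> \<alpha> * c"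
  proof (induction i rule: less_induct)
    case (less i)
    have "0 \<le> c" using c less.prems by force
    then have "\<alpha> * c \<le> c" using \<alpha> by (simp add: mult_left_le_one_le)
    moreover have "\<bar>batch_op n A p g \<alpha> m x j - batch_op n A p g \<alpha> m y j\<bar> \<le> \<alpha> * c"
      if "j \<in> batch m i" for j
      using less.IH[OF batch_less[OF that]] batch_subset[OF less.prems] that by blast
    ultimately show ?case
      unfolding batch_op_eq_bellman[OF less.prems]
      by (intro contraction_onD[OF contraction_bellman _ less.prems]) (use c in force)
  qed
qed

lemma batch_op_fixed:
  assumes V: "\<And>i. i \<in> {1..n} \<Longrightarrow> bellman V i = V i" and "i \<in> {1..n}"
  shows "batch_op n A p g \<alpha> m V i = V i"
  using \<open>i \<in> {1..n}\<close>
proof (induction i rule: less_induct)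
  case (less i)
  have "batch_op n A p g \<alpha> m V j = V j" if "j \<in> batch m i" for j
    using less.IH[OF batch_less[OF that]] batch_subset[OF less.prems] that by blast
  then have "batch_op n A p g \<alpha> m V i = bellman V i"
    unfolding batch_op_eq_bellman[OF less.prems] by (intro bellman_cong) simp
  then show ?case using V less.prems by simp
qed

lemma bellman_solution:
  obtains V where "\<And>i. i \<in> {1..n} \<Longrightarrow> bellman V i = V i"
  using contraction_on_fixed_exists[OF contraction_bellman] \<alpha> by auto

lemma batch_op_tendsto:
  assumes "\<And>i. i \<in> {1..n} \<Longrightarrow> bellman V i = V i" and "i \<in> {1..n}"
  shows "(\<lambda>k. (batch_op n A p g \<alpha> m ^^ k) J i) \<longlonglongrightarrow> V i"
  using \<alpha> assms
  by (intro contraction_on_iterates_tendsto[OF contraction_batch_op]) (auto intro: batch_op_fixed)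

end

section \<open>Policies as Markov decision processes without choice\<close>

lemma (in mdp) mdp_policy:
  assumes "\<mu> \<in> policies n A"
  shows "mdp n U (\<lambda>i. {\<mu> i}) p \<alpha>"
  using mdp assms by unfold_locales (auto simp: finite_mdp_def policies_def PiE_iff)

lemma policy_batch_op_eq_batch_op:
  "policy_batch_op n p g \<alpha> \<mu> m J i = batch_op n (\<lambda>i. {\<mu> i}) p g \<alpha> m J i"
proof (induction i rule: less_induct)
  case (less i)
  then show ?case
    by (subst policy_batch_op.simps, subst batch_op.simps) (simp add: batch_less)
qed

definition stage_cost ::
  "(nat \<Rightarrow> 'u \<Rightarrow> nat pmf) \<Rightarrow> (nat \<Rightarrow> 'u \<Rightarrow> real) \<Rightarrow> real \<Rightarrow> (nat \<Rightarrow> 'u) \<Rightarrow> nat \<Rightarrow> nat \<Rightarrow> real" where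
  "stage_cost p g \<alpha> \<mu> N i = measure_pmf.expectation (trajectory p \<mu> N i)
                (\<lambda>\<omega>. \<Sum>t<N. \<alpha> ^ t * g (\<omega> ! t) (\<mu> (\<omega> ! t)))"

context
  fixes n :: nat and U :: "'u set" and \<mu> :: "nat \<Rightarrow> 'u"
    and p :: "nat \<Rightarrow> 'u \<Rightarrow> nat pmf" and g :: "nat \<Rightarrow> 'u \<Rightarrow> real" and \<alpha> :: real
  assumes policy: "mdp n U (\<lambda>i. {\<mu> i}) p \<alpha>"
begin

interpretation mdp n U "\<lambda>i. {\<mu> i}" p g \<alpha>
  by (rule policy)

lemma finite_trajectory: "i \<in> {1..n} \<Longrightarrow> finite (set_pmf (trajectory p \<mu> N i))"
proof (induction N arbitrary: i)
  case (Suc N)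
  have "set_pmf (p i (\<mu> i)) \<subseteq> {1..n}"
    by (rule successors[OF Suc.prems]) simp
  with Suc.IH finite_subset[OF this] show ?case by auto
qed simp

text \<open>
  Conditioning on the first transition: after it, the process is the same one restarted at the
  successor, with every cost discounted once more.
\<close>

lemma stage_cost_Suc:
  assumes i: "i \<in> {1..n}"
  shows "stage_cost p g \<alpha> \<mu> (Suc N) i = bellman (stage_cost p g \<alpha> \<mu> N) i"
proof -
  let ?h = "\<lambda>N \<omega>. \<Sum>t<N. \<alpha> ^ t * g (\<omega> ! t) (\<mu> (\<omega> ! t))"
  let ?P = "\<lambda>j. pmf (p i (\<mu> i)) j"
  have supp: "set_pmf (p i (\<mu> i)) \<subseteq> {1..n}"
    by (rule successors[OF i]) simp
  have shift: "?h (Suc N) (i # \<omega>) = g i (\<mu> i) + \<alpha> * ?h N \<omega>" for \<omega>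
    by (simp add: sum.lessThan_Suc_shift sum_distrib_left mult.assoc del: sum.lessThan_Suc)
  have restart: "measure_pmf.expectation (map_pmf ((#) i) (trajectory p \<mu> N j)) (?h (Suc N))
      = g i (\<mu> i) + \<alpha> * stage_cost p g \<alpha> \<mu> N j" if "j \<in> {1..n}" for j
  proof -
    have int: "integrable (trajectory p \<mu> N j) f" for f :: "nat list \<Rightarrow> real"
      by (rule integrable_measure_pmf_finite) (rule finite_trajectory[OF that])
    show ?thesis
      unfolding integral_map_pmf shift stage_cost_def
      by (subst Bochner_Integration.integral_add) (auto intro: int)
  qed
  have "stage_cost p g \<alpha> \<mu> (Suc N) i = (\<Sum>j\<in>{1..n}. ?P j *\<^sub>R
      measure_pmf.expectation (map_pmf ((#) i) (trajectory p \<mu> N j)) (?h (Suc N)))"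
    unfolding stage_cost_def trajectory.simps
    by (rule pmf_expectation_bind[OF _ _ supp]) (auto simp: finite_trajectory)
  also have "\<dots> = (\<Sum>j\<in>{1..n}. ?P j * (g i (\<mu> i) + \<alpha> * stage_cost p g \<alpha> \<mu> N j))"
    by (intro sum.cong refl) (simp only: restart real_scaleR_def)
  also have "\<dots> = (\<Sum>j\<in>{1..n}. ?P j) * g i (\<mu> i)
      + \<alpha> * (\<Sum>j\<in>{1..n}. ?P j * stage_cost p g \<alpha> \<mu> N j)"
    by (simp add: distrib_left sum.distrib sum_distrib_right sum_distrib_left mult.left_commute)
  also have "(\<Sum>j\<in>{1..n}. ?P j) = 1"
    by (rule sum_pmf_eq_1[OF _ supp]) simp
  finally show ?thesis by (simp add: bellman_def)
qed

lemma policy_cost_eq: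
  assumes V: "\<And>i. i \<in> {1..n} \<Longrightarrow> bellman V i = V i" and i: "i \<in> {1..n}"
  shows "policy_cost p g \<alpha> \<mu> i = V i"
proof -
  have "stage_cost p g \<alpha> \<mu> N j = (bellman ^^ N) (\<lambda>_. 0) j" if "j \<in> {1..n}" for N j
    using that
  proof (induction N arbitrary: j)
    case 0
    then show ?case by (simp add: stage_cost_def)
  next
    case (Suc N)
    have "bellman (stage_cost p g \<alpha> \<mu> N) j = bellman ((bellman ^^ N) (\<lambda>_. 0)) j"
      by (rule bellman_cong) (rule Suc.IH)
    then show ?case by (simp add: stage_cost_Suc[OF Suc.prems])
  qed
  moreover have "(\<lambda>N. (bellman ^^ N) (\<lambda>_. 0) i) \<longlonglongrightarrow> V i"
    using \<alpha> V i by (intro contraction_on_iterates_tendsto[OF contraction_bellman]) auto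
  ultimately have "(\<lambda>N. stage_cost p g \<alpha> \<mu> N i) \<longlonglongrightarrow> V i"
    using i by simp
  then show ?thesis
    unfolding policy_cost_def stage_cost_def by (rule limI)
qed

lemma bellman_policy_cost:
  assumes i: "i \<in> {1..n}"
  shows "bellman (policy_cost p g \<alpha> \<mu>) i = policy_cost p g \<alpha> \<mu> i"
proof -
  obtain V where V: "bellman V i = V i" if "i \<in> {1..n}" for i
    using bellman_solution by blast
  have "bellman (policy_cost p g \<alpha> \<mu>) i = bellman V i"
    by (rule bellman_cong) (rule policy_cost_eq[OF V])
  then show ?thesis
    using V[OF i] policy_cost_eq[OF V i] by simp
qed

lemma policy_cost_equation:
  assumes i: "i \<in> {1..n}"
  shows "policy_cost p g \<alpha> \<mu> i =
    g i (\<mu> i) + \<alpha> * (\<Sum>j\<in>{1..n}. pmf (p i (\<mu> i)) j * policy_cost p g \<alpha> \<mu> j)"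
  using bellman_policy_cost[OF i] by (simp add: bellman_def)

lemma policy_cost_eqI:
  assumes "\<And>i. i \<in> {1..n} \<Longrightarrow>
      V i = g i (\<mu> i) + \<alpha> * (\<Sum>j\<in>{1..n}. pmf (p i (\<mu> i)) j * V j)"
    and "i \<in> {1..n}"
  shows "policy_cost p g \<alpha> \<mu> i = V i"
  by (rule policy_cost_eq) (use assms in \<open>simp_all add: bellman_def\<close>)

lemma policy_batch_op_tendsto:
  assumes i: "i \<in> {1..n}"
  shows "(\<lambda>k. (policy_batch_op n p g \<alpha> \<mu> m ^^ k) J i) \<longlonglongrightarrow> policy_cost p g \<alpha> \<mu> i"
proof -
  have "policy_batch_op n p g \<alpha> \<mu> m = batch_op n (\<lambda>i. {\<mu> i}) p g \<alpha> m"
    by (intro ext policy_batch_op_eq_batch_op)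
  moreover have "(\<lambda>k. (batch_op n (\<lambda>i. {\<mu> i}) p g \<alpha> m ^^ k) J i)
      \<longlonglongrightarrow> policy_cost p g \<alpha> \<mu> i"
    by (rule batch_op_tendsto[where V = "policy_cost p g \<alpha> \<mu>", OF bellman_policy_cost i])
  ultimately show ?thesis by simp
qed

end

section \<open>The optimal cost solves the Bellman equation\<close>

context mdp
begin

text \<open>
  The excess of \<open>V\<close> over the policy cost is at most \<open>\<alpha>\<close> times one of its own averages. At a state
  where it is largest this forces it to be nonpositive.
\<close>

lemma bellman_solution_le_policy_cost:
  assumes V: "\<And>i. i \<in> {1..n} \<Longrightarrow> bellman V i = V i"
    and \<mu>: "\<mu> \<in> policies n A" and i: "i \<in> {1..n}"
  shows "V i \<le> policy_cost p g \<alpha> \<mu> i"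
proof -
  define D where "D j = V j - policy_cost p g \<alpha> \<mu> j" for j
  have "Max (D ` {1..n}) \<in> D ` {1..n}"
    using i by (intro Max_in) auto
  then obtain s where s: "s \<in> {1..n}" "D s = Max (D ` {1..n})" by auto
  have D_le: "D j \<le> D s" if "j \<in> {1..n}" for j
    unfolding s(2) using that by (intro Max_ge) auto
  have \<mu>s: "\<mu> s \<in> A s" using \<mu> s by (auto simp: policies_def)
  have "bellman V s \<le> g s (\<mu> s) + \<alpha> * (\<Sum>j\<in>{1..n}. pmf (p s (\<mu> s)) j * V j)"
    unfolding bellman_def using controls[OF s(1)] \<mu>s by (intro Min_le) auto
  then have "V s \<le> g s (\<mu> s) + \<alpha> * (\<Sum>j\<in>{1..n}. pmf (p s (\<mu> s)) j * V j)"
    using V[OF s(1)] by simp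
  then have "D s \<le> \<alpha> * (\<Sum>j\<in>{1..n}. pmf (p s (\<mu> s)) j * D j)"
    using policy_cost_equation[OF mdp_policy[OF \<mu>] s(1), of g]
    by (simp add: D_def right_diff_distrib sum_subtractf)
  also have "\<dots> \<le> \<alpha> * D s"
    using \<alpha> by (intro mult_left_mono weighted_mean_le[OF s(1) \<mu>s] D_le) auto
  finally have "(1 - \<alpha>) * D s \<le> 0" by (simp add: algebra_simps)
  then have "D s \<le> 0" using \<alpha> by (simp add: mult_le_0_iff)
  with D_le[OF i] show ?thesis by (simp add: D_def)
qed

text \<open>
  Attainment: a policy that chooses a minimising control in the Bellman equation at every state has
  \<open>V\<close> as a solution of its own evaluation equation, so its cost is \<open>V\<close> at all states at once.
\<close>

lemma optimal_cost_eq: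
  assumes V: "\<And>i. i \<in> {1..n} \<Longrightarrow> bellman V i = V i" and i: "i \<in> {1..n}"
  shows "optimal_cost n A p g \<alpha> i = V i"
proof -
  let ?q = "\<lambda>i u. g i u + \<alpha> * (\<Sum>j\<in>{1..n}. pmf (p i u) j * V j)"
  have "\<exists>u\<in>A j. ?q j u = V j" if j: "j \<in> {1..n}" for j
  proof -
    have "bellman V j \<in> ?q j ` A j"
      unfolding bellman_def using controls[OF j] by (intro Min_in) auto
    then show ?thesis using V[OF j] by auto
  qed
  then obtain \<nu> where \<nu>: "\<nu> j \<in> A j" "?q j (\<nu> j) = V j" if "j \<in> {1..n}" for j
    by metis
  define \<mu> where "\<mu> = restrict \<nu> {1..n}"
  have \<mu>: "\<mu> \<in> policies n A" using \<nu> by (auto simp: \<mu>_def policies_def)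
  have "V j = ?q j (\<mu> j)" if "j \<in> {1..n}" for j
    using \<nu>(2)[OF that] that by (simp add: \<mu>_def)
  then have "policy_cost p g \<alpha> \<mu> i = V i"
    by (rule policy_cost_eqI[OF mdp_policy[OF \<mu>] _ i])
  moreover have "finite (policies n A)"
    unfolding policies_def using controls by (intro finite_PiE) auto
  ultimately show ?thesis
    unfolding optimal_cost_def using \<mu> bellman_solution_le_policy_cost[OF V _ i]
    by (intro Min_eqI) force+
qed

end

section \<open>Convergence of the mini-batch iterations\<close>

theorem mainTheorem4:
  fixes n m :: nat and U :: "'u set" and A :: "nat \<Rightarrow> 'u set"
    and p :: "nat \<Rightarrow> 'u \<Rightarrow> nat pmf" and g :: "nat \<Rightarrow> 'u \<Rightarrow> real" and \<alpha> :: real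
    and J :: "nat \<Rightarrow> real"
  assumes "finite_mdp n U A p \<alpha>"
    and "1 \<le> m" and "m \<le> n"
  shows "(\<forall>i\<in>{1..n}. (\<lambda>k. (batch_op n A p g \<alpha> m ^^ k) J i)
       \<longlonglongrightarrow> optimal_cost n A p g \<alpha> i) \<and>
    (\<forall>\<mu>\<in>policies n A. \<forall>i\<in>{1..n}. (\<lambda>k. (policy_batch_op n p g \<alpha> \<mu> m ^^ k) J i)
       \<longlonglongrightarrow> policy_cost p g \<alpha> \<mu> i)"
proof -
  interpret mdp n U A p g \<alpha>
    by unfold_locales (rule assms(1))
  obtain V where V: "bellman V i = V i" if "i \<in> {1..n}" for i
    using bellman_solution by blast
  have "(\<lambda>k. (batch_op n A p g \<alpha> m ^^ k) J i) \<longlonglongrightarrow> optimal_cost n A p g \<alpha> i"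
    if "i \<in> {1..n}" for i
    using batch_op_tendsto[OF V that] optimal_cost_eq[OF V that] by simp
  then show ?thesis
    using policy_batch_op_tendsto[OF mdp_policy] by blast
qed

end
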